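(* Let $K$ be a space equipped with a measure $\mu$, a metric $d$ and a positive-definite symmetric quadratic form $\mathcal{E}$ on $L^2(K,\mu)$. Assume that there are positive constants $b,\theta,C_1,C_2$, with $\theta<2$, such that the upper $b$-regularity condition $$\mu(B_r(x))\leq C_1 r^b\qquad\text{for all } x\in K \text{ and } r>0$$ holds, and such that the Nash inequality $$\|f\|_2^{2+4/\theta}\leq C_2\,\mathcal{E}(f,f)\,\|f\|_1^{4/\theta}$$ holds for all $f\in\mathcal{D}om(\mathcal{E})$. Let $\gamma=\frac{2b}{\theta}$. Then there exists a constant $C>0$ such that for all $u\in\mathcal{D}om(\mathcal{E})$ with $\|u\|_2=1$ one has $$Var_\gamma(u)\,\mathcal{E}(u,u)\geq C.$$
   Context: $(K,d)$ is a metric space equipped with a Borel measure $\mu$, and $\mathcal{E}$ has domain $\mathcal{D}om(\mathcal{E})\subset L^2(K,\mu)$; it is not assumed to be a Dirichlet form. $B_r(x)$ denotes the ball with center $x$ and radius $r$ in the metric $d$. $\|\cdot\|_p$ is the norm of $L^p(K,\mu)$, taken to be $\infty$ if the function is not in $L^p(K,\mu)$. The spatial variance is $$Var_\gamma(u)=\iint_{K\times K}d(x,y)^\gamma |u(x)|^2|u(y)|^2\,d\mu(x)\,d\mu(y).$$ The constant $C$ does not depend on $u$. *)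

theory Defs
  imports "HOL-Analysis.Analysis"
begin

text \<open>Elements of $L^p$ are represented by Borel functions rather than by classes of functions
  modulo almost everywhere equality.\<close>

definition Lp_space :: "'a measure \<Rightarrow> real \<Rightarrow> ('a \<Rightarrow> real) set" where
  "Lp_space M p = {f \<in> borel_measurable M. integrable M (\<lambda>x. \<bar>f x\<bar> powr p)}"

definition Lp_norm :: "'a measure \<Rightarrow> real \<Rightarrow> ('a \<Rightarrow> real) \<Rightarrow> ennreal" where
  "Lp_norm M p f =
     (if f \<in> Lp_space M p then ennreal ((\<integral>x. \<bar>f x\<bar> powr p \<partial>M) powr (1 / p)) else \<infinity>)"

text \<open>Only used for positive exponents \<open>p\<close>, for which infinity to the power \<open>p\<close> is infinity.\<close>

definition ennreal_powr :: "ennreal \<Rightarrow> real \<Rightarrow> ennreal" where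
  "ennreal_powr x p = (if x = \<infinity> then \<infinity> else ennreal (enn2real x powr p))"

text \<open>A quadratic form is given by its associated bilinear form \<open>E\<close>, defined on a subspace \<open>D\<close> of
  the real $L^2$ space. The values of \<open>E\<close> outside \<open>D\<close> are irrelevant. The two assumptions on almost
  everywhere equal functions say that \<open>D\<close> and \<open>E\<close> live on $L^2$ classes. The form is
  neither required to be closed or densely defined nor to be Markovian.\<close>

locale positive_definite_form =
  fixes M :: "'a measure"
    and D :: "('a \<Rightarrow> real) set"
    and E :: "('a \<Rightarrow> real) \<Rightarrow> ('a \<Rightarrow> real) \<Rightarrow> real"
  assumes domain_L2: "D \<subseteq> Lp_space M 2"
    and domain_zero: "(\<lambda>x. 0) \<in> D"
    and domain_add: "\<And>f g. f \<in> D \<Longrightarrow> g \<in> D \<Longrightarrow> (\<lambda>x. f x + g x) \<in> D"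
    and domain_scale: "\<And>c f. f \<in> D \<Longrightarrow> (\<lambda>x. c * f x) \<in> D"
    and domain_AE: "\<And>f g. f \<in> D \<Longrightarrow> g \<in> borel_measurable M \<Longrightarrow> (AE x in M. f x = g x) \<Longrightarrow> g \<in> D"
    and form_AE: "\<And>f g h. f \<in> D \<Longrightarrow> g \<in> D \<Longrightarrow> h \<in> D \<Longrightarrow> (AE x in M. f x = g x) \<Longrightarrow> E f h = E g h"
    and form_sym: "\<And>f g. f \<in> D \<Longrightarrow> g \<in> D \<Longrightarrow> E f g = E g f"
    and form_add: "\<And>f g h. f \<in> D \<Longrightarrow> g \<in> D \<Longrightarrow> h \<in> D \<Longrightarrow> E (\<lambda>x. f x + g x) h = E f h + E g h"
    and form_scale: "\<And>c f h. f \<in> D \<Longrightarrow> h \<in> D \<Longrightarrow> E (\<lambda>x. c * f x) h = c * E f h"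
    and form_pos: "\<And>f. f \<in> D \<Longrightarrow> \<not> (AE x in M. f x = 0) \<Longrightarrow> E f f > 0"

text \<open>The iterated integral is used because on a non-separable space the distance need not be
  measurable for the product of the Borel sigma-algebras.\<close>

definition spatial_variance :: "'a::metric_space measure \<Rightarrow> real \<Rightarrow> ('a \<Rightarrow> real) \<Rightarrow> ennreal" where
  "spatial_variance M \<gamma> u =
     (\<integral>\<^sup>+x. \<integral>\<^sup>+y. ennreal (dist x y powr \<gamma> * \<bar>u x\<bar>\<^sup>2 * \<bar>u y\<bar>\<^sup>2) \<partial>M \<partial>M)"

end

theory Submission
  imports Defs
begin

text \<open>By averaging, there is a point \<open>x\<close> at which
  \<open>\<integral> d(x, y)\<^sup>\<gamma> |u(y)|\<^sup>2 d\<mu>(y)\<close> is at most \<open>w = r\<^sup>\<gamma>\<close>, where \<open>w\<close> is any number larger than the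
  spatial variance. Since \<open>\<theta> < 2\<close> means \<open>b < \<gamma>\<close>, upper regularity bounds the integral of
  \<open>1 / (r\<^sup>\<gamma> + d(x, y)\<^sup>\<gamma>)\<close> by a multiple of \<open>r\<close> to the power \<open>b - \<gamma>\<close>, so that the weighted inequality
  between arithmetic and geometric mean bounds the $L^1$ norm of \<open>u\<close> by a multiple of \<open>r\<close> to the
  power \<open>b/2\<close>. Its power \<open>4/\<theta>\<close> is then at most a multiple of \<open>w\<close>, and the Nash inequality
  gives the claim as \<open>w\<close> tends to the variance.\<close>

text \<open>For the least \<open>k\<close> with \<open>y\<close> in the ball of radius
  \<open>2 ^ k * r\<close>, the \<open>k\<close>-th summand alone dominates: if
  \<open>k > 0\<close>, then \<open>y\<close> lies outside the ball of half that radius, and this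
  loss of a factor 2 in the distance costs the constant \<open>2 powr \<gamma>\<close>. A sum of
  indicators of balls can be integrated using nothing but upper regularity.\<close>

lemma inverse_dist_powr_le_suminf_balls:
  fixes x y :: "'a::metric_space"
  assumes "r > 0" "\<gamma> > 0"
  shows "ennreal (1 / (r powr \<gamma> + dist x y powr \<gamma>))
    \<le> (\<Sum>k. ennreal (2 powr \<gamma> * (2 powr (- \<gamma>)) ^ k * r powr (- \<gamma>)) * indicator (ball x (2 ^ k * r)) y)"
proof -
  have "\<exists>k::nat. dist x y < 2 ^ k * r"
    using real_arch_pow[of 2 "dist x y / r"] \<open>r > 0\<close> by (auto simp: field_simps)
  then obtain k where k: "dist x y < 2 ^ k * r" "\<And>j. j < k \<Longrightarrow> \<not> dist x y < 2 ^ j * r"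
    using exists_least_iff[of "\<lambda>k. dist x y < 2 ^ k * r"] by blast
  define c where "c = (\<lambda>k. 2 powr \<gamma> * (2 powr (- \<gamma>)) ^ k * r powr (- \<gamma>))"
  have rpos: "r powr \<gamma> > 0" using \<open>r > 0\<close> by simp
  have "1 / (r powr \<gamma> + dist x y powr \<gamma>) \<le> c k"
  proof (cases k)
    case 0
    \<comment> \<open>Here \<open>r powr \<gamma>\<close> in the denominator suffices; the factor
      \<open>2 powr \<gamma>\<close> is slack that lets one formula for \<open>c\<close> serve every
      \<open>k\<close>.\<close>
    have "1 / (r powr \<gamma> + dist x y powr \<gamma>) \<le> 1 / r powr \<gamma>"
      using rpos by (intro divide_left_mono mult_pos_pos add_pos_nonneg) auto
    also have "\<dots> \<le> 2 powr \<gamma> * (1 / r powr \<gamma>)"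
      using rpos \<open>\<gamma> > 0\<close> ge_one_powr_ge_zero[of 2 \<gamma>] mult_right_mono[of 1 "2 powr \<gamma>" "1 / r powr \<gamma>"]
      by simp
    finally show ?thesis by (simp add: c_def 0 powr_minus field_simps)
  next
    case (Suc j)
    have "(2 ^ j * r) powr \<gamma> \<le> dist x y powr \<gamma>"
      using k(2)[of j] Suc assms by (intro powr_mono2) auto
    moreover have "(2 ^ j * r) powr \<gamma> > 0" using \<open>r > 0\<close> by simp
    ultimately have "1 / (r powr \<gamma> + dist x y powr \<gamma>) \<le> 1 / (2 ^ j * r) powr \<gamma>"
      using rpos by (intro frac_le) linarith+
    \<comment> \<open>The factor \<open>2 powr \<gamma>\<close> in \<open>c\<close> makes up for the
      shift from \<open>k\<close> to its predecessor \<open>j\<close>.\<close>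
    also have "\<dots> = c k"
    proof -
      have "(2 ^ j * r) powr \<gamma> = (2 powr \<gamma>) ^ j * r powr \<gamma>"
        using \<open>r > 0\<close> by (simp add: powr_mult powr_power flip: powr_realpow)
           (simp add: powr_powr mult.commute)
      then show ?thesis
        using \<open>r > 0\<close> by (simp add: c_def Suc powr_minus power_inverse field_simps)
    qed
    finally show ?thesis .
  qed
  then have "ennreal (1 / (r powr \<gamma> + dist x y powr \<gamma>))
      \<le> (\<Sum>i\<in>{k}. ennreal (c i) * indicator (ball x (2 ^ i * r)) y)"
    using k(1) by (simp add: ennreal_leI)
  also have "\<dots> \<le> (\<Sum>i. ennreal (c i) * indicator (ball x (2 ^ i * r)) y)"
    by (intro sum_le_suminf) auto
  finally show ?thesis by (simp add: c_def)
qed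

text \<open>Integrating the dyadic bound term by term, the growth \<open>2 powr (b * k)\<close> of
  the ball measures meets the decay \<open>2 powr (- \<gamma> * k)\<close> of the coefficients. What
  remains is a geometric series of ratio \<open>2 powr (b - \<gamma>)\<close>, which converges
  because \<open>b < \<gamma>\<close>.\<close>

lemma nn_integral_inverse_dist_powr_le:
  fixes M :: "'a::metric_space measure"
  assumes borel: "sets M = sets borel"
    and "0 < b" "b < \<gamma>" "C1 > 0" "r > 0"
    and regular: "\<And>x r. r > 0 \<Longrightarrow> emeasure M (ball x r) \<le> ennreal (C1 * r powr b)"
  shows "(\<integral>\<^sup>+y. ennreal (1 / (r powr \<gamma> + dist x y powr \<gamma>)) \<partial>M)
    \<le> ennreal (2 powr \<gamma> * C1 / (1 - 2 powr (b - \<gamma>)) * r powr (b - \<gamma>))"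
proof -
  define c where "c = (\<lambda>k. 2 powr \<gamma> * (2 powr (- \<gamma>)) ^ k * r powr (- \<gamma>))"
  define q :: real where "q = 2 powr (b - \<gamma>)"
  define K where "K = 2 powr \<gamma> * C1 * r powr (b - \<gamma>)"
  have [measurable]: "ball z s \<in> sets M" for z s using borel by simp
  have q: "0 < q" "q < 1"
    using assms powr_less_mono[of "b - \<gamma>" 0 2] by (auto simp: q_def)
  have c_pos: "c k \<ge> 0" for k by (simp add: c_def)
  have cK: "c k * (C1 * (2 ^ k * r) powr b) = K * q ^ k" for k
  proof -
    have "(2 ^ k * r) powr b = (2 powr b) ^ k * r powr b"
      using \<open>r > 0\<close> by (simp add: powr_mult powr_power flip: powr_realpow)
         (simp add: powr_powr mult.commute)
    moreover have "q ^ k = (2 powr b) ^ k * (2 powr (- \<gamma>)) ^ k"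
      by (simp add: q_def flip: power_mult_distrib powr_add)
    moreover have "r powr (b - \<gamma>) = r powr b * r powr (- \<gamma>)"
      by (simp flip: powr_add)
    ultimately show ?thesis by (simp add: c_def K_def)
  qed
  have "(\<integral>\<^sup>+y. ennreal (1 / (r powr \<gamma> + dist x y powr \<gamma>)) \<partial>M)
      \<le> (\<integral>\<^sup>+y. (\<Sum>k. ennreal (c k) * indicator (ball x (2 ^ k * r)) y) \<partial>M)"
    unfolding c_def using assms
    by (intro nn_integral_mono inverse_dist_powr_le_suminf_balls) auto
  also have "\<dots> = (\<Sum>k. ennreal (c k) * emeasure M (ball x (2 ^ k * r)))"
    by (subst nn_integral_suminf) (auto simp: nn_integral_cmult_indicator)
  also have "\<dots> \<le> (\<Sum>k. ennreal (K * q ^ k))"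
  proof (intro suminf_le summableI)
    fix k
    have "ennreal (c k) * emeasure M (ball x (2 ^ k * r))
        \<le> ennreal (c k) * ennreal (C1 * (2 ^ k * r) powr b)"
      using \<open>r > 0\<close> by (intro mult_left_mono regular) auto
    then show "ennreal (c k) * emeasure M (ball x (2 ^ k * r)) \<le> ennreal (K * q ^ k)"
      using c_pos[of k] by (simp add: cK flip: ennreal_mult')
  qed
  also have "\<dots> = ennreal (\<Sum>k. K * q ^ k)"
    using q \<open>C1 > 0\<close> by (intro suminf_ennreal2 summable_mult summable_geometric) (auto simp: K_def)
  also have "(\<Sum>k. K * q ^ k) = K / (1 - q)"
    using q by (simp add: suminf_mult suminf_geometric summable_geometric)
  finally show ?thesis by (simp add: K_def q_def)
qed

lemma abs_le_weighted_am_gm: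
  fixes a s :: real
  assumes "s > 0"
  shows "\<bar>a\<bar> \<le> s * \<bar>a\<bar>\<^sup>2 + 1 / s"
proof -
  \<comment> \<open>The added \<open>s * \<bar>a\<bar>\<close> gives away the factor 2 of the sharp
    inequality.\<close>
  have "0 \<le> (s * \<bar>a\<bar> - 1)\<^sup>2 + s * \<bar>a\<bar>" using assms by simp
  then have "\<bar>a\<bar> * s \<le> (s * \<bar>a\<bar>\<^sup>2 + 1 / s) * s"
    using assms by (simp add: power2_eq_square algebra_simps)
  with assms show ?thesis by simp
qed

text \<open>The inequality \<open>abs_le_weighted_am_gm\<close> with \<open>s\<close> a multiple of
  \<open>r powr \<gamma> + dist x y powr \<gamma>\<close> splits the integral of
  \<open>\<bar>u y\<bar>\<close> into three parts, controlled by the $L^2$ mass, the moment and the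
  tail integral. The summand \<open>r powr \<gamma>\<close> keeps the weight away from zero near
  \<open>x\<close>.\<close>

lemma nn_integral_abs_le_of_moment:
  fixes M :: "'a::metric_space measure"
  assumes borel: "sets M = sets borel" and [measurable]: "u \<in> borel_measurable M"
    and "r > 0" "A \<ge> 0"
    and u2: "(\<integral>\<^sup>+y. ennreal (\<bar>u y\<bar>\<^sup>2) \<partial>M) = 1"
    and moment: "(\<integral>\<^sup>+y. ennreal (dist x y powr \<gamma> * \<bar>u y\<bar>\<^sup>2) \<partial>M) \<le> ennreal (r powr \<gamma>)"
    and tail: "(\<integral>\<^sup>+y. ennreal (1 / (r powr \<gamma> + dist x y powr \<gamma>)) \<partial>M) \<le> ennreal (A * r powr (b - \<gamma>))"
  shows "(\<integral>\<^sup>+y. ennreal \<bar>u y\<bar> \<partial>M) \<le> ennreal ((2 + A) * r powr (b / 2))"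
proof -
  \<comment> \<open>This \<open>t\<close> balances the parts: \<open>t * r powr \<gamma>\<close> and
    \<open>r powr (b - \<gamma>) / t\<close> both equal \<open>r powr (b / 2)\<close>.\<close>
  define t where "t = r powr (b / 2 - \<gamma>)"
  have t: "t > 0" using \<open>r > 0\<close> by (simp add: t_def)
  have rpos: "r powr \<gamma> > 0" using \<open>r > 0\<close> by simp
  have [measurable]: "dist x \<in> borel_measurable M"
    using borel by (simp add: measurable_cong_sets[OF borel refl] borel_measurable_continuous_onI continuous_on_dist)
  have *: "ennreal \<bar>u y\<bar> \<le> ennreal (t * r powr \<gamma>) * ennreal (\<bar>u y\<bar>\<^sup>2)
      + ennreal t * ennreal (dist x y powr \<gamma> * \<bar>u y\<bar>\<^sup>2)
      + ennreal (1 / t) * ennreal (1 / (r powr \<gamma> + dist x y powr \<gamma>))" for y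
  proof -
    have "\<bar>u y\<bar> \<le> t * (r powr \<gamma> + dist x y powr \<gamma>) * \<bar>u y\<bar>\<^sup>2 + 1 / (t * (r powr \<gamma> + dist x y powr \<gamma>))"
      using t rpos by (intro abs_le_weighted_am_gm mult_pos_pos add_pos_nonneg) auto
    also have "\<dots> = t * r powr \<gamma> * \<bar>u y\<bar>\<^sup>2 + t * (dist x y powr \<gamma> * \<bar>u y\<bar>\<^sup>2)
        + 1 / t * (1 / (r powr \<gamma> + dist x y powr \<gamma>))"
      by (simp add: algebra_simps)
    finally show ?thesis
      using t by (simp add: ennreal_leI flip: ennreal_mult' ennreal_plus)
  qed
  have "(\<integral>\<^sup>+y. ennreal \<bar>u y\<bar> \<partial>M)
      \<le> (\<integral>\<^sup>+y. ennreal (t * r powr \<gamma>) * ennreal (\<bar>u y\<bar>\<^sup>2)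
      + ennreal t * ennreal (dist x y powr \<gamma> * \<bar>u y\<bar>\<^sup>2)
      + ennreal (1 / t) * ennreal (1 / (r powr \<gamma> + dist x y powr \<gamma>)) \<partial>M)"
    by (intro nn_integral_mono *)
  also have "\<dots> = ennreal (t * r powr \<gamma>) * (\<integral>\<^sup>+y. ennreal (\<bar>u y\<bar>\<^sup>2) \<partial>M)
      + ennreal t * (\<integral>\<^sup>+y. ennreal (dist x y powr \<gamma> * \<bar>u y\<bar>\<^sup>2) \<partial>M)
      + ennreal (1 / t) * (\<integral>\<^sup>+y. ennreal (1 / (r powr \<gamma> + dist x y powr \<gamma>)) \<partial>M)"
    by (simp add: nn_integral_add nn_integral_cmult)
  also have "\<dots> \<le> ennreal (t * r powr \<gamma>) * 1 + ennreal t * ennreal (r powr \<gamma>)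
      + ennreal (1 / t) * ennreal (A * r powr (b - \<gamma>))"
    unfolding u2 by (intro add_mono mult_left_mono moment tail) auto
  also have "\<dots> = ennreal (t * r powr \<gamma> + t * r powr \<gamma> + 1 / t * (A * r powr (b - \<gamma>)))"
    using t \<open>A \<ge> 0\<close> by (simp flip: ennreal_mult' ennreal_plus)
  also have "t * r powr \<gamma> + t * r powr \<gamma> + 1 / t * (A * r powr (b - \<gamma>)) = (2 + A) * r powr (b / 2)"
  proof -
    have "t * r powr \<gamma> = r powr (b / 2)" by (simp add: t_def flip: powr_add)
    moreover have "r powr (b - \<gamma>) / t = r powr (b / 2)"
      by (simp add: t_def flip: powr_diff)
    ultimately show ?thesis by (simp add: algebra_simps)
  qed
  finally show ?thesis .
qed

lemma nn_integral_eq_one_if_Lp_norm_2_eq_one: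
  assumes "Lp_norm M 2 u = 1"
  shows "u \<in> borel_measurable M" "(\<integral>\<^sup>+y. ennreal (\<bar>u y\<bar>\<^sup>2) \<partial>M) = 1"
proof -
  \<comment> \<open>A finite value of \<open>Lp_norm\<close> excludes its infinite branch.\<close>
  have L: "u \<in> Lp_space M 2" using assms by (auto simp: Lp_norm_def split: if_splits)
  then show "u \<in> borel_measurable M" by (simp add: Lp_space_def)
  have i: "integrable M (\<lambda>y. \<bar>u y\<bar>\<^sup>2)" using L by (simp add: Lp_space_def)
  have "(\<integral>y. \<bar>u y\<bar>\<^sup>2 \<partial>M) powr (1 / 2) = 1"
    using assms L by (simp add: Lp_norm_def)
  then have "(\<integral>y. \<bar>u y\<bar>\<^sup>2 \<partial>M) = 1"
    by (simp add: powr_half_sqrt)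
  then show "(\<integral>\<^sup>+y. ennreal (\<bar>u y\<bar>\<^sup>2) \<partial>M) = 1"
    using nn_integral_eq_integral[OF i] by simp
qed

text \<open>Both sides are infinite when \<open>u\<close> is not integrable, so a bound on the
  nonnegative integral bounds the norm without a separate proof of integrability.\<close>

lemma Lp_norm_1_eq_nn_integral:
  assumes [measurable]: "u \<in> borel_measurable M"
  shows "Lp_norm M 1 u = (\<integral>\<^sup>+y. ennreal \<bar>u y\<bar> \<partial>M)"
proof (cases "integrable M (\<lambda>y. \<bar>u y\<bar>)")
  case True
  then show ?thesis by (simp add: Lp_norm_def Lp_space_def nn_integral_eq_integral)
next
  case False
  then have "(\<integral>\<^sup>+y. ennreal \<bar>u y\<bar> \<partial>M) = \<infinity>"
    by (simp add: integrable_iff_bounded less_top[symmetric])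
  with False show ?thesis by (simp add: Lp_norm_def Lp_space_def)
qed

lemma ennreal_powr_mono:
  assumes "p \<ge> 0" "x \<le> y"
  shows "ennreal_powr x p \<le> ennreal_powr y p"
  using assms
  by (auto simp: ennreal_powr_def top_unique less_top intro!: ennreal_leI powr_mono2 enn2real_mono)

text \<open>The density \<open>\<bar>u x\<bar>\<^sup>2\<close> has total mass 1, and the spatial
  variance is the average of the moment at \<open>x\<close> with respect to it. A moment of at least
  \<open>w\<close> at every point would force the average up to \<open>w\<close>.\<close>

lemma exists_moment_le_of_spatial_variance_less:
  fixes M :: "'a::metric_space measure"
  assumes borel: "sets M = sets borel" and [measurable]: "u \<in> borel_measurable M"
    and u2: "(\<integral>\<^sup>+y. ennreal (\<bar>u y\<bar>\<^sup>2) \<partial>M) = 1"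
    and less: "spatial_variance M \<gamma> u < w"
  shows "\<exists>x. (\<integral>\<^sup>+y. ennreal (dist x y powr \<gamma> * \<bar>u y\<bar>\<^sup>2) \<partial>M) \<le> w"
proof (rule ccontr)
  assume "\<not> ?thesis"
  then have w: "w \<le> (\<integral>\<^sup>+y. ennreal (dist x y powr \<gamma> * \<bar>u y\<bar>\<^sup>2) \<partial>M)" for x
    by (meson linear)
  have "w = (\<integral>\<^sup>+x. ennreal (\<bar>u x\<bar>\<^sup>2) * w \<partial>M)"
    using u2 by (subst nn_integral_multc) auto
  also have "\<dots> \<le> spatial_variance M \<gamma> u"
    unfolding spatial_variance_def
  proof (intro nn_integral_mono)
    fix x
    \<comment> \<open>The inner integral involves only the distance from a fixed point, which is
      continuous and hence Borel.\<close>
    have [measurable]: "dist x \<in> borel_measurable M"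
      using borel by (simp add: measurable_cong_sets[OF borel refl] borel_measurable_continuous_onI continuous_on_dist)
    have "ennreal (\<bar>u x\<bar>\<^sup>2) * w \<le> ennreal (\<bar>u x\<bar>\<^sup>2) * (\<integral>\<^sup>+y. ennreal (dist x y powr \<gamma> * \<bar>u y\<bar>\<^sup>2) \<partial>M)"
      by (intro mult_left_mono w) auto
    also have "\<dots> = (\<integral>\<^sup>+y. ennreal (\<bar>u x\<bar>\<^sup>2) * ennreal (dist x y powr \<gamma> * \<bar>u y\<bar>\<^sup>2) \<partial>M)"
      by (simp add: nn_integral_cmult)
    also have "\<dots> = (\<integral>\<^sup>+y. ennreal (dist x y powr \<gamma> * \<bar>u x\<bar>\<^sup>2 * \<bar>u y\<bar>\<^sup>2) \<partial>M)"
      by (simp add: mult_ac flip: ennreal_mult')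
    finally show "ennreal (\<bar>u x\<bar>\<^sup>2) * w \<le> (\<integral>\<^sup>+y. ennreal (dist x y powr \<gamma> * \<bar>u x\<bar>\<^sup>2 * \<bar>u y\<bar>\<^sup>2) \<partial>M)" .
  qed
  finally show False using less by simp
qed

theorem theorem7:
  fixes M :: "'a::metric_space measure"
    and D :: "('a \<Rightarrow> real) set"
    and E :: "('a \<Rightarrow> real) \<Rightarrow> ('a \<Rightarrow> real) \<Rightarrow> real"
    and b \<theta> C1 C2 \<gamma> :: real
  assumes borel: "sets M = sets borel"
    and form: "positive_definite_form M D E"
    and pos: "b > 0" "\<theta> > 0" "C1 > 0" "C2 > 0"
    and theta: "\<theta> < 2"
    and regular: "\<And>x r. r > 0 \<Longrightarrow> emeasure M (ball x r) \<le> ennreal (C1 * r powr b)"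
    and Nash: "\<And>f. f \<in> D \<Longrightarrow>
      ennreal_powr (Lp_norm M 2 f) (2 + 4 / \<theta>)
        \<le> ennreal C2 * ennreal (E f f) * ennreal_powr (Lp_norm M 1 f) (4 / \<theta>)"
    and gamma: "\<gamma> = 2 * b / \<theta>"
  shows "\<exists>C::real. C > 0 \<and>
    (\<forall>u\<in>D. Lp_norm M 2 u = 1 \<longrightarrow> spatial_variance M \<gamma> u * ennreal (E u u) \<ge> ennreal C)"
proof -
  have "b < \<gamma>" using pos theta by (simp add: gamma field_simps)
  have "\<gamma> > 0" using pos by (simp add: gamma)
  define A where "A = 2 powr \<gamma> * C1 / (1 - 2 powr (b - \<gamma>))"
  have "A > 0"
    using \<open>b < \<gamma>\<close> pos powr_less_mono[of "b - \<gamma>" 0 2] by (simp add: A_def)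
  \<comment> \<open>The Nash constant times the power \<open>4 / \<theta>\<close> of the constant in
    the $L^1$ bound. It is fixed before \<open>u\<close> is, and the constant sought is
    \<open>1 / B\<close>.\<close>
  define B where "B = C2 * (2 + A) powr (4 / \<theta>)"
  have "B > 0" using pos \<open>A > 0\<close> by (simp add: B_def)
  have "ennreal (1 / B) \<le> spatial_variance M \<gamma> u * ennreal (E u u)"
    if u: "u \<in> D" and norm: "Lp_norm M 2 u = 1" for u
  proof -
    note um = nn_integral_eq_one_if_Lp_norm_2_eq_one[OF norm]
    have nash: "1 \<le> ennreal C2 * ennreal (E u u) * ennreal_powr (Lp_norm M 1 u) (4 / \<theta>)"
      using Nash[OF u] norm by (simp add: ennreal_powr_def)
    \<comment> \<open>A nonpositive \<open>E u u\<close> becomes 0 under \<open>ennreal\<close>. The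
      right side of the Nash inequality would then vanish, even for an infinite $L^1$ norm, since 0
      times infinity is 0.\<close>
    have Epos: "E u u > 0"
    proof (rule ccontr)
      assume "\<not> ?thesis"
      then have "ennreal (E u u) = 0" by (simp add: ennreal_neg)
      with nash show False by simp
    qed
    have key: "1 \<le> B * w * E u u"
      if less: "spatial_variance M \<gamma> u < ennreal w" and "w > 0" for w
    proof -
      \<comment> \<open>The radius is chosen so that the moment bound \<open>w\<close> reads
        \<open>r powr \<gamma>\<close>.\<close>
      define r where "r = w powr (1 / \<gamma>)"
      have "r > 0" using \<open>w > 0\<close> by (simp add: r_def)
      have rw: "r powr \<gamma> = w" using \<open>w > 0\<close> \<open>\<gamma> > 0\<close> by (simp add: r_def powr_powr)
      obtain x where x: "(\<integral>\<^sup>+y. ennreal (dist x y powr \<gamma> * \<bar>u y\<bar>\<^sup>2) \<partial>M) \<le> ennreal (r powr \<gamma>)"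
        using exists_moment_le_of_spatial_variance_less[OF borel um less] rw by auto
      have "Lp_norm M 1 u \<le> ennreal ((2 + A) * r powr (b / 2))"
        unfolding Lp_norm_1_eq_nn_integral[OF um(1)]
        using nn_integral_abs_le_of_moment[OF borel um(1) \<open>r > 0\<close> _ um(2) x]
          nn_integral_inverse_dist_powr_le[OF borel pos(1) \<open>b < \<gamma>\<close> pos(3) \<open>r > 0\<close> regular]
          \<open>A > 0\<close> by (simp add: A_def)
      then have "ennreal_powr (Lp_norm M 1 u) (4 / \<theta>)
          \<le> ennreal_powr (ennreal ((2 + A) * r powr (b / 2))) (4 / \<theta>)"
        using pos by (intro ennreal_powr_mono) auto
      also have "\<dots> = ennreal (((2 + A) * r powr (b / 2)) powr (4 / \<theta>))"
        using \<open>A > 0\<close> by (simp add: ennreal_powr_def)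
      also have "((2 + A) * r powr (b / 2)) powr (4 / \<theta>) = (2 + A) powr (4 / \<theta>) * w"
      proof -
        \<comment> \<open>This is where the exponent \<open>\<gamma> = 2 * b / \<theta>\<close>
          comes from: it makes the Nash inequality linear in \<open>w\<close>.\<close>
        have "(r powr (b / 2)) powr (4 / \<theta>) = r powr \<gamma>" by (simp add: powr_powr gamma)
        then show ?thesis using \<open>A > 0\<close> rw by (simp add: powr_mult)
      qed
      finally have "1 \<le> ennreal C2 * ennreal (E u u) * ennreal ((2 + A) powr (4 / \<theta>) * w)"
        using nash by (meson mult_left_mono order_trans zero_le)
      also have "\<dots> = ennreal (B * w * E u u)"
        using pos Epos \<open>w > 0\<close> by (simp add: B_def mult_ac flip: ennreal_mult')
      finally show ?thesis by simp
    qed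
    show ?thesis
    proof (cases "spatial_variance M \<gamma> u")
      \<comment> \<open>With \<open>E u u\<close> positive, the product is infinite as well.\<close>
      case top
      then show ?thesis using Epos by (simp add: ennreal_top_mult)
    next
      case (real v)
      have "1 / (B * E u u) \<le> v"
      \<comment> \<open>Averaging needs a bound strictly above the variance, so \<open>w\<close>
        ranges over all reals greater than \<open>v\<close>. They are positive even if
        \<open>v\<close> is 0.\<close>
      proof (rule dense_ge)
        fix w assume "v < w"
        then have "1 \<le> B * w * E u u" using real by (intro key) (auto intro!: ennreal_lessI)
        then show "1 / (B * E u u) \<le> w" using \<open>B > 0\<close> Epos by (simp add: field_simps)
      qed
      then have "1 / B \<le> v * E u u" using \<open>B > 0\<close> Epos by (simp add: field_simps)
      then show ?thesis using real by (simp add: ennreal_leI flip: ennreal_mult')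
    qed
  qed
  with \<open>B > 0\<close> show ?thesis by (intro exI[of _ "1 / B"]) auto
qed

end
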